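(* Let $H$ be a separable real Hilbert space, $U\subset H$ an infinite dimensional closed subspace, and $Q\in L(H)$ a nonnegative self-adjoint nuclear operator such that $U$ and $U^\perp$ are $Q$-invariant. Consider the statistical model $(\mathbb{P}_\vartheta)_{\vartheta\in\Theta}$ on $H$ with $\Theta=U\times(0,\infty)$ and $\mathbb{P}_\vartheta=\mathrm{N}(\zeta,\sigma^2Q)$ for $\vartheta=(\zeta,\sigma)$, with observation $Y$. Assume there are an orthonormal system $(f_k)_{k\in\mathbb{N}}$ in $H$ and numbers $(\mu_k)_{k\in\mathbb{N}}\subset(0,\infty)$ with $\sum_{k=1}^\infty\mu_k<\infty$ such that $U=\overline{\operatorname{lin}}\{f_k:k\in\mathbb{N}\}$ and $Qf_k=\mu_kf_k$ for all $k\in\mathbb{N}$. Set $V_n:=\operatorname{lin}\{f_1,\ldots,f_n\}$, $\widehat{\zeta}_n(Y):=\Pi_{V_n}Y$ for $n\in\mathbb{N}$, and $\widehat{\zeta}(Y):=\Pi_UY$. Then for each $\vartheta=(\zeta,\sigma)\in\Theta$ we have, for all $n\in\mathbb{N}$, $$R_\vartheta[\widehat{\zeta}_n(Y)]-R_\vartheta[\widehat{\zeta}(Y)]=\sum_{k=n+1}^\infty(\zeta_k^2-\sigma^2\mu_k),$$ and this converges to $0$ as $n\to\infty$, where $\zeta_k:=\langle\zeta,f_k\rangle$ for each $k\in\mathbb{N}$.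
   Context: A subspace $V$ is $Q$-invariant if $Q(V)\subset V$. $\Pi_V$ is the orthogonal projection onto a closed subspace $V$. $\mathrm{N}(\zeta,\sigma^2Q)$ is the Gaussian measure on $H$ with mean $\zeta$ and covariance operator $\sigma^2Q$, i.e. if $Y$ has this law then $\langle b,Y\rangle\sim\mathrm{N}(\langle b,\zeta\rangle,\sigma^2\langle Qb,b\rangle)$ (possibly degenerate) for all $b\in H$. $Y$ is the observation (the identity map on $H$), so $Y\sim\mathrm{N}(\zeta,\sigma^2Q)$ under $\mathbb{P}_\vartheta$, and $\mathbb{E}_\vartheta$ is expectation under $\mathbb{P}_\vartheta$. The risk of an estimator $T(Y)$ of $\zeta$ is $R_\vartheta[T(Y)]:=\mathbb{E}_\vartheta[\|T(Y)-\zeta\|^2]$. *)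

theory Defs
  imports "HOL-Probability.Probability"
begin

text \<open>
  The type class \<^class>\<open>real_inner\<close> together with \<^class>\<open>polish_space\<close> (completeness and
  second countability) describes the separable real Hilbert spaces.
\<close>

definition invariant_under :: "('a::real_inner \<Rightarrow>\<^sub>L 'a) \<Rightarrow> 'a set \<Rightarrow> bool" where
  "invariant_under Q V \<longleftrightarrow> blinfun_apply Q ` V \<subseteq> V"

definition self_adjoint_op :: "('a::real_inner \<Rightarrow>\<^sub>L 'a) \<Rightarrow> bool" where
  "self_adjoint_op Q \<longleftrightarrow> (\<forall>x y. inner (blinfun_apply Q x) y = inner x (blinfun_apply Q y))"

definition nonneg_op :: "('a::real_inner \<Rightarrow>\<^sub>L 'a) \<Rightarrow> bool" where
  "nonneg_op Q \<longleftrightarrow> (\<forall>x. 0 \<le> inner (blinfun_apply Q x) x)"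

text \<open>Nuclear operators, as \<open>Q x = (\<Sum>k. \<langle>a k, x\<rangle> b k)\<close> with \<open>(\<Sum>k. \<parallel>a k\<parallel> \<parallel>b k\<parallel>) < \<infinity>\<close>.\<close>

definition nuclear_op :: "('a::real_inner \<Rightarrow>\<^sub>L 'a) \<Rightarrow> bool" where
  "nuclear_op Q \<longleftrightarrow> (\<exists>a b :: nat \<Rightarrow> 'a.
     summable (\<lambda>k. norm (a k) * norm (b k)) \<and>
     (\<forall>x. (\<lambda>k. inner (a k) x *\<^sub>R b k) sums blinfun_apply Q x))"

definition orthonormal_system :: "('i \<Rightarrow> 'a::real_inner) \<Rightarrow> bool" where
  "orthonormal_system f \<longleftrightarrow> (\<forall>j k. inner (f j) (f k) = (if j = k then 1 else 0))"

definition infinite_dimensional :: "'a::real_vector set \<Rightarrow> bool" where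
  "infinite_dimensional U \<longleftrightarrow> \<not> (\<exists>B. finite B \<and> U \<subseteq> span B)"

text \<open>The orthogonal projection; the description is meaningful for a closed subspace \<open>V\<close> of a
  Hilbert space, where such a \<open>z\<close> exists and is unique.\<close>

definition orth_proj :: "'a::real_inner set \<Rightarrow> 'a \<Rightarrow> 'a" where
  "orth_proj V y = (THE z. z \<in> V \<and> y - z \<in> V\<^sup>\<bottom>)"

text \<open>The second parameter is the variance; variance \<open>0\<close> gives the point mass.\<close>

definition normal_measure :: "real \<Rightarrow> real \<Rightarrow> real measure" where
  "normal_measure m v =
     (if v = 0 then return borel m else density lborel (\<lambda>x. ennreal (normal_density m (sqrt v) x)))"

text \<open>\<open>is_gaussian M m C\<close>: \<open>M\<close> is the Gaussian measure \<open>N(m, C)\<close> on the Borel sets of the space.\<close>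

definition is_gaussian :: "'a::real_inner measure \<Rightarrow> 'a \<Rightarrow> ('a \<Rightarrow>\<^sub>L 'a) \<Rightarrow> bool" where
  "is_gaussian M m C \<longleftrightarrow> prob_space M \<and> sets M = sets borel \<and>
     (\<forall>b. distr M borel (inner b) = normal_measure (inner b m) (inner (blinfun_apply C b) b))"

text \<open>The observation \<open>Y\<close> is the identity map, so that the estimator \<open>T(Y)\<close> at \<open>y\<close> is \<open>T y\<close>. Since the
  Bochner integral of a non-integrable function is \<open>0\<close>, finiteness of the risk is expressed
  separately.\<close>

definition sq_loss :: "('a \<Rightarrow> 'a) \<Rightarrow> 'a \<times> real \<Rightarrow> 'a::real_inner \<Rightarrow> real" where
  "sq_loss T \<theta> y = (norm (T y - fst \<theta>))\<^sup>2"

definition risk :: "('a \<times> real \<Rightarrow> 'a::real_inner measure) \<Rightarrow> 'a \<times> real \<Rightarrow> ('a \<Rightarrow> 'a) \<Rightarrow> real" where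
  "risk P \<theta> T = integral\<^sup>L (P \<theta>) (sq_loss T \<theta>)"

definition finite_risk :: "('a \<times> real \<Rightarrow> 'a::real_inner measure) \<Rightarrow> 'a \<times> real \<Rightarrow> ('a \<Rightarrow> 'a) \<Rightarrow> bool" where
  "finite_risk P \<theta> T \<longleftrightarrow> integrable (P \<theta>) (sq_loss T \<theta>)"

end

theory Submission
  imports Defs
begin

text \<open>
  Write \<open>c\<^sub>k(y) = \<langle>y, f\<^sub>k\<rangle>\<close>. Both kinds of estimators are coordinate selectors: \<open>T y\<close> lies in \<open>U\<close>, its
  \<open>k\<close>-th coordinate is \<open>c\<^sub>k(y)\<close> for \<open>k\<close> in a set \<open>I\<close> of indices, and \<open>0\<close> for all other \<open>k\<close>. The
  projection onto \<open>V\<^sub>n\<close> has \<open>I = {..<n}\<close>, the projection onto \<open>U\<close> has all indices. As \<open>\<zeta>\<close> is also in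
  \<open>U\<close>, Parseval's identity (\<open>parseval_closure_span\<close>) splits the loss into coordinates,

  \<open>\<parallel>T y - \<zeta>\<parallel>\<^sup>2 = (\<Sum>k\<in>I. (c\<^sub>k(y) - \<zeta>\<^sub>k)\<^sup>2) + (\<Sum>k\<notin>I. \<zeta>\<^sub>k\<^sup>2)\<close>.

  Each \<open>c\<^sub>k\<close> is normal with mean \<open>\<zeta>\<^sub>k\<close> and variance \<open>\<sigma>\<^sup>2 \<mu>\<^sub>k\<close>, because \<open>f\<^sub>k\<close> is an eigenvector of \<open>Q\<close>. The
  terms of the series being nonnegative, it can be integrated term by term
  (\<open>integral_coordinate_selection\<close>): a selected coordinate contributes its variance \<open>\<sigma>\<^sup>2 \<mu>\<^sub>k\<close> to the
  risk, an omitted one its squared bias \<open>\<zeta>\<^sub>k\<^sup>2\<close>. Hence the risks of the two projections differ exactly in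
  the coordinates \<open>k \<ge> n\<close>, where bias replaces variance. Bessel's inequality and the summability
  of \<open>\<mu>\<close> make \<open>\<zeta>\<^sub>k\<^sup>2 - \<sigma>\<^sup>2 \<mu>\<^sub>k\<close> summable, so these differences are the tails of a convergent series
  and tend to \<open>0\<close>.
\<close>

section \<open>Orthonormal expansions\<close>

lemma inner_orthonormal_sum:
  assumes "orthonormal_system f" and "finite F"
  shows "inner (\<Sum>j\<in>F. c j *\<^sub>R f j) (f k) = (if k \<in> F then c k else 0)"
proof -
  have "inner (\<Sum>j\<in>F. c j *\<^sub>R f j) (f k) = (\<Sum>j\<in>F. if k = j then c j else 0)"
    using assms(1) unfolding inner_sum_left orthonormal_system_def by (intro sum.cong) auto
  then show ?thesis
    using assms(2) by (simp add: sum.delta)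
qed

lemma norm_orthonormal_sum:
  assumes "orthonormal_system f" and "finite F"
  shows "(norm (\<Sum>j\<in>F. c j *\<^sub>R f j))\<^sup>2 = (\<Sum>j\<in>F. (c j)\<^sup>2)"
  unfolding power2_norm_eq_inner inner_sum_right inner_scaleR_right
    inner_orthonormal_sum[OF assms]
  by (intro sum.cong) (auto simp: power2_eq_square)

lemma bessel_summable:
  fixes f :: "nat \<Rightarrow> 'a::real_inner"
  assumes "orthonormal_system f"
  shows "summable (\<lambda>k. (inner y (f k))\<^sup>2)"
proof (rule summableI_nonneg_bounded)
  fix n
  let ?s = "\<Sum>k<n. inner y (f k) *\<^sub>R f k"
  have "inner (y - ?s) ?s = (\<Sum>k<n. inner y (f k) * inner (y - ?s) (f k))"
    by (simp add: inner_sum_right)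
  also have "\<dots> = 0"
    by (simp add: inner_diff_left inner_orthonormal_sum[OF assms])
  finally have "(norm ((y - ?s) + ?s))\<^sup>2 = (norm (y - ?s))\<^sup>2 + (norm ?s)\<^sup>2"
    by (intro norm_add_Pythagorean) (simp add: orthogonal_def)
  then show "(\<Sum>k<n. (inner y (f k))\<^sup>2) \<le> (norm y)\<^sup>2"
    using norm_orthonormal_sum[OF assms, of "{..<n}" "\<lambda>k. inner y (f k)"] by simp
qed simp

text \<open>
  The partial sums of a square-summable expansion are Cauchy, since by Pythagoras the squared norm
  of a block is the same block of the series of squares. The argument is
  phrased with \<^const>\<open>Cauchy\<close> and not with \<^const>\<open>summable\<close> because the sort
  \<open>{real_inner, complete_space}\<close> is not a subsort of \<^class>\<open>banach\<close>.
\<close>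

lemma orthonormal_expansion_converges:
  fixes f :: "nat \<Rightarrow> 'a::{real_inner, complete_space}"
  assumes f: "orthonormal_system f" and c: "summable (\<lambda>k. (c k)\<^sup>2)"
  obtains z where "(\<lambda>n. \<Sum>k<n. c k *\<^sub>R f k) \<longlonglongrightarrow> z"
proof -
  have "Cauchy (\<lambda>n. \<Sum>k<n. c k *\<^sub>R f k)"
  proof (rule CauchyI')
    fix e :: real
    assume e: "0 < e"
    then obtain N where N: "\<And>m n. N \<le> m \<Longrightarrow> norm (\<Sum>k=m..<n. (c k)\<^sup>2) < e\<^sup>2"
      using c unfolding summable_Cauchy by (metis zero_less_power)
    have "norm ((\<Sum>k<m. c k *\<^sub>R f k) - (\<Sum>k<n. c k *\<^sub>R f k)) < e" if "N \<le> m" "m < n" for m n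
    proof -
      have "(\<Sum>k<n. c k *\<^sub>R f k) - (\<Sum>k<m. c k *\<^sub>R f k) = (\<Sum>k=m..<n. c k *\<^sub>R f k)"
        using that(2) sum_diff_nat_ivl[of 0 m n "\<lambda>k. c k *\<^sub>R f k"] by (simp add: atLeast0LessThan)
      then have "(norm ((\<Sum>k<m. c k *\<^sub>R f k) - (\<Sum>k<n. c k *\<^sub>R f k)))\<^sup>2 = (\<Sum>k=m..<n. (c k)\<^sup>2)"
        using norm_orthonormal_sum[OF f, of "{m..<n}" c] by (metis finite_atLeastLessThan norm_minus_commute)
      also have "\<dots> < e\<^sup>2"
        using N[OF that(1), of n] by simp
      finally show ?thesis
        using e by (simp add: power_less_imp_less_base)
    qed
    then show "\<exists>M. \<forall>m\<ge>M. \<forall>n>m. dist (\<Sum>k<m. c k *\<^sub>R f k) (\<Sum>k<n. c k *\<^sub>R f k) < e"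
      unfolding dist_norm by blast
  qed
  then show thesis
    using that Cauchy_convergent convergent_def by blast
qed

lemma subspace_closure:
  fixes V :: "'a::real_normed_vector set"
  assumes V: "subspace V"
  shows "subspace (closure V)"
  unfolding subspace_def
proof (intro conjI ballI allI)
  show "0 \<in> closure V"
    using V closure_subset subspace_0 by blast
next
  fix x y
  assume "x \<in> closure V" "y \<in> closure V"
  then obtain X Y where "\<And>n. X n \<in> V" "X \<longlonglongrightarrow> x" "\<And>n. Y n \<in> V" "Y \<longlonglongrightarrow> y"
    by (metis closure_sequential)
  then have "(\<forall>n. X n + Y n \<in> V) \<and> (\<lambda>n. X n + Y n) \<longlonglongrightarrow> x + y"
    using V by (auto intro: subspace_add tendsto_add)
  then show "x + y \<in> closure V"
    unfolding closure_sequential by (intro exI)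
next
  fix c x
  assume "x \<in> closure V"
  then obtain X where "\<And>n. X n \<in> V" "X \<longlonglongrightarrow> x"
    by (metis closure_sequential)
  then have "(\<forall>n. c *\<^sub>R X n \<in> V) \<and> (\<lambda>n. c *\<^sub>R X n) \<longlonglongrightarrow> c *\<^sub>R x"
    using V by (auto intro: subspace_scale tendsto_scaleR)
  then show "c *\<^sub>R x \<in> closure V"
    unfolding closure_sequential by (intro exI)
qed

lemma orthogonal_closure_span:
  assumes "\<And>s. s \<in> S \<Longrightarrow> inner s x = 0"
  shows "x \<in> (closure (span S))\<^sup>\<bottom>"
proof -
  have "span S \<subseteq> {z. inner z x = 0}"
    using assms by (intro span_minimal) (auto simp: subspace_def inner_add_left)
  moreover have "closed {z. inner z x = 0}"
    by (intro closed_Collect_eq continuous_intros)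
  ultimately have "closure (span S) \<subseteq> {z. inner z x = 0}"
    by (rule closure_minimal)
  then show ?thesis
    by (auto simp: orthogonal_comp_def orthogonal_def)
qed

text \<open>
  The expansion converges to the orthogonal projection of \<open>y\<close>. Each coordinate of the partial sums is
  eventually constant, equal to that of \<open>y\<close>, so the limit has the same coordinates as \<open>y\<close>, and the
  remainder is orthogonal to every \<open>f k\<close>.
\<close>

lemma orthogonal_expansion_remainder:
  fixes f :: "nat \<Rightarrow> 'a::{real_inner, complete_space}"
  assumes f: "orthonormal_system f"
  obtains z where "(\<lambda>n. \<Sum>k<n. inner y (f k) *\<^sub>R f k) \<longlonglongrightarrow> z"
    and "z \<in> closure (span (range f))" and "y - z \<in> (closure (span (range f)))\<^sup>\<bottom>"
proof -
  obtain z where z: "(\<lambda>n. \<Sum>k<n. inner y (f k) *\<^sub>R f k) \<longlonglongrightarrow> z"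
    using orthonormal_expansion_converges[OF f bessel_summable[OF f]] .
  have "(\<Sum>k<n. inner y (f k) *\<^sub>R f k) \<in> closure (span (range f))" for n
    by (intro subsetD[OF closure_subset] span_sum span_scale span_base) simp
  then have z_in: "z \<in> closure (span (range f))"
    by (intro closed_sequentially[OF closed_closure _ z]) auto
  have "inner (f k) (y - z) = 0" for k
  proof -
    have "(\<lambda>n. inner (\<Sum>j<n. inner y (f j) *\<^sub>R f j) (f k)) \<longlonglongrightarrow> inner z (f k)"
      by (intro tendsto_intros z)
    moreover have "\<forall>\<^sub>F n in sequentially. inner (\<Sum>j<n. inner y (f j) *\<^sub>R f j) (f k) = inner y (f k)"
      using eventually_gt_at_top[of k]
      by eventually_elim (simp add: inner_orthonormal_sum[OF f])
    ultimately have "inner z (f k) = inner y (f k)"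
      by (rule LIMSEQ_unique[OF _ tendsto_eventually])
    then show ?thesis
      by (simp add: inner_diff_right inner_commute)
  qed
  then have "y - z \<in> (closure (span (range f)))\<^sup>\<bottom>"
    by (intro orthogonal_closure_span) auto
  with z z_in show thesis
    using that by blast
qed

text \<open>
  For \<open>u\<close> in the closed span, the expansion of \<open>u\<close> converges to \<open>u\<close> itself: the difference is both in
  the closed span and orthogonal to it.
\<close>

lemma parseval_closure_span:
  fixes f :: "nat \<Rightarrow> 'a::{real_inner, complete_space}"
  assumes f: "orthonormal_system f" and u: "u \<in> closure (span (range f))"
  shows "(\<lambda>k. (inner u (f k))\<^sup>2) sums (norm u)\<^sup>2"
proof -
  obtain z where z: "(\<lambda>n. \<Sum>k<n. inner u (f k) *\<^sub>R f k) \<longlonglongrightarrow> z"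
    and z_in: "z \<in> closure (span (range f))" and perp: "u - z \<in> (closure (span (range f)))\<^sup>\<bottom>"
    using orthogonal_expansion_remainder[OF f] .
  have "u - z \<in> closure (span (range f))"
    by (intro subspace_diff subspace_span subspace_closure u z_in)
  with perp have "u = z"
    by (auto simp: orthogonal_comp_def orthogonal_def)
  then have "(\<lambda>n. (norm (\<Sum>k<n. inner u (f k) *\<^sub>R f k))\<^sup>2) \<longlonglongrightarrow> (norm u)\<^sup>2"
    using z by (intro tendsto_intros) simp
  then show ?thesis
    by (simp add: sums_def norm_orthonormal_sum[OF f])
qed

section \<open>Orthogonal projections in coordinates\<close>

lemma orth_proj_eqI:
  assumes V: "subspace V" and z: "z \<in> V" "y - z \<in> V\<^sup>\<bottom>"
  shows "orth_proj V y = z"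
  unfolding orth_proj_def
proof (rule the_equality)
  fix w
  assume w: "w \<in> V \<and> y - w \<in> V\<^sup>\<bottom>"
  \<comment> \<open>Two candidates differ by a vector that is orthogonal to itself.\<close>
  then have "w - z \<in> V"
    using V z(1) by (simp add: subspace_diff)
  moreover have "(y - z) - (y - w) \<in> V\<^sup>\<bottom>"
    using w z(2) subspace_diff[OF subspace_orthogonal_comp] by blast
  ultimately show "w = z"
    by (auto simp: orthogonal_comp_def orthogonal_def)
qed (use z in simp)

lemma orth_proj_finite_span:
  assumes f: "orthonormal_system f" and F: "finite F"
  shows "orth_proj (span (f ` F)) y = (\<Sum>k\<in>F. inner y (f k) *\<^sub>R f k)"
proof (rule orth_proj_eqI)
  let ?s = "\<Sum>k\<in>F. inner y (f k) *\<^sub>R f k"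
  show "?s \<in> span (f ` F)"
    by (intro span_sum span_scale span_base) simp
  have "inner (f k) (y - ?s) = 0" if "k \<in> F" for k
    using that inner_orthonormal_sum[OF f F, of "\<lambda>k. inner y (f k)" k]
    by (metis inner_commute inner_diff_right right_minus_eq)
  then have "y - ?s \<in> (closure (span (f ` F)))\<^sup>\<bottom>"
    by (intro orthogonal_closure_span) auto
  then show "y - ?s \<in> (span (f ` F))\<^sup>\<bottom>"
    using orthogonal_comp_anti_mono[OF closure_subset] by blast
qed simp

lemma orth_proj_closure_span:
  fixes f :: "nat \<Rightarrow> 'a::{real_inner, complete_space}"
  assumes f: "orthonormal_system f"
  shows "orth_proj (closure (span (range f))) y \<in> closure (span (range f))"
    and "inner (orth_proj (closure (span (range f))) y) (f k) = inner y (f k)"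
proof -
  obtain z where z: "z \<in> closure (span (range f))" "y - z \<in> (closure (span (range f)))\<^sup>\<bottom>"
    using orthogonal_expansion_remainder[OF f] by metis
  then have eq: "orth_proj (closure (span (range f))) y = z"
    by (intro orth_proj_eqI subspace_closure) simp_all
  show "orth_proj (closure (span (range f))) y \<in> closure (span (range f))"
    using eq z(1) by simp
  have "f k \<in> closure (span (range f))"
    by (intro subsetD[OF closure_subset] span_base) simp
  with z(2) show "inner (orth_proj (closure (span (range f))) y) (f k) = inner y (f k)"
    unfolding eq by (auto simp: orthogonal_comp_def orthogonal_def inner_diff_right inner_commute)
qed

section \<open>The risk of a coordinate selector\<close>

lemma normal_measure_variance:
  assumes "0 \<le> v"
  shows "has_bochner_integral (normal_measure m v) (\<lambda>x. (x - m)\<^sup>2) v"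
proof (cases "v = 0")
  case True
  then show ?thesis
    using has_bochner_integral_cong_AE[of "\<lambda>x. (x - m)\<^sup>2" "return borel m" "\<lambda>_. 0" 0]
    by (simp add: normal_measure_def AE_return has_bochner_integral_zero)
next
  case False
  with assms have "has_bochner_integral lborel (\<lambda>x. normal_density m (sqrt v) x *\<^sub>R (x - m)\<^sup>2) v"
    using normal_moment_even[of "sqrt v" m 1] by (simp add: fact_numeral)
  with False show ?thesis
    unfolding normal_measure_def by (auto intro!: has_bochner_integral_density)
qed

lemma gaussian_coordinate_variance:
  fixes M :: "'a::real_inner measure"
  assumes M: "is_gaussian M m C" and v: "0 \<le> inner (blinfun_apply C b) b"
  shows "has_bochner_integral M (\<lambda>y. (inner y b - inner m b)\<^sup>2) (inner (blinfun_apply C b) b)"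
proof -
  have "continuous_on UNIV (inner b)"
    by (intro continuous_intros)
  then have meas: "inner b \<in> M \<rightarrow>\<^sub>M borel"
    using M measurable_cong_sets[of M borel borel borel]
    by (auto simp: is_gaussian_def borel_measurable_continuous_onI)
  have "has_bochner_integral (distr M borel (inner b)) (\<lambda>x. (x - inner b m)\<^sup>2)
      (inner (blinfun_apply C b) b)"
    using M normal_measure_variance[OF v] by (simp add: is_gaussian_def)
  then show ?thesis
    using meas by (simp add: has_bochner_integral_iff integrable_distr_eq integral_distr inner_commute)
qed

text \<open>
  By Parseval the loss is a series of nonnegative terms, one per coordinate, whose expectations are
  variances or squared biases. Termwise integration needs these expectations to be summable: the
  variances are so by assumption, the squared biases by Bessel's inequality. This also
  gives the finiteness of the risk.
\<close>

lemma integral_coordinate_selection: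
  fixes f :: "nat \<Rightarrow> 'a::{real_inner, complete_space}" and M :: "'a measure"
  assumes f: "orthonormal_system f"
    and M: "is_gaussian M \<zeta> C"
    and v: "\<And>k. inner (blinfun_apply C (f k)) (f k) = v k" "\<And>k. 0 \<le> v k" "summable v"
    and \<zeta>: "\<zeta> \<in> closure (span (range f))"
    and T: "\<And>y. T y \<in> closure (span (range f))"
      "\<And>y k. inner (T y) (f k) = (if k \<in> I then inner y (f k) else 0)"
  shows "integrable M (\<lambda>y. (norm (T y - \<zeta>))\<^sup>2)"
    and "(\<lambda>k. if k \<in> I then v k else (inner \<zeta> (f k))\<^sup>2) sums (\<integral>y. (norm (T y - \<zeta>))\<^sup>2 \<partial>M)"
proof -
  interpret prob_space M
    using M by (simp add: is_gaussian_def)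
  let ?g = "\<lambda>k y. if k \<in> I then (inner y (f k) - inner \<zeta> (f k))\<^sup>2 else (inner \<zeta> (f k))\<^sup>2"
  let ?r = "\<lambda>k. if k \<in> I then v k else (inner \<zeta> (f k))\<^sup>2"
  have loss: "(\<lambda>k. ?g k y) sums (norm (T y - \<zeta>))\<^sup>2" for y
  proof -
    have "(\<lambda>k. (inner (T y - \<zeta>) (f k))\<^sup>2) sums (norm (T y - \<zeta>))\<^sup>2"
      by (intro parseval_closure_span f subspace_diff subspace_closure subspace_span T \<zeta>)
    moreover have "(inner (T y - \<zeta>) (f k))\<^sup>2 = ?g k y" for k
      by (simp add: inner_diff_left T)
    ultimately show ?thesis
      by simp
  qed
  have term_integral: "has_bochner_integral M (?g k) (?r k)" for k
    using gaussian_coordinate_variance[OF M, of "f k"] v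
    by (auto simp: has_bochner_integral_iff prob_space)
  have g_norm: "norm (?g k y) = ?g k y" for k y
    by simp
  have "summable (\<lambda>k. v k + (inner \<zeta> (f k))\<^sup>2)"
    by (intro summable_add v bessel_summable f)
  then have r_summable: "summable ?r"
    by (rule summable_comparison_test_ev[rotated]) (use v in \<open>auto intro!: always_eventually\<close>)
  have int: "integrable M (?g k)" "integral\<^sup>L M (?g k) = ?r k" for k
    using term_integral[of k] by (auto simp: has_bochner_integral_iff)
  have summable: "AE y in M. summable (\<lambda>k. norm (?g k y))" "summable (\<lambda>k. \<integral>y. norm (?g k y) \<partial>M)"
    unfolding g_norm int using loss r_summable by (auto simp: sums_iff)
  have loss_eq: "(\<Sum>k. ?g k y) = (norm (T y - \<zeta>))\<^sup>2" for y
    using loss by (simp add: sums_iff)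
  show "integrable M (\<lambda>y. (norm (T y - \<zeta>))\<^sup>2)"
    using integrable_suminf[OF int(1) summable] unfolding loss_eq .
  show "?r sums (\<integral>y. (norm (T y - \<zeta>))\<^sup>2 \<partial>M)"
    using sums_integral[OF int(1) summable] unfolding loss_eq int .
qed

section \<open>Comparison of the two risks\<close>

lemma suminf_tail_tendsto_0:
  fixes a :: "nat \<Rightarrow> 'a::real_normed_vector"
  assumes "summable a"
  shows "(\<lambda>n. \<Sum>k. a (n + k)) \<longlonglongrightarrow> 0"
proof -
  have "(\<lambda>n. (\<Sum>k. a k) - (\<Sum>k<n. a k)) \<longlonglongrightarrow> (\<Sum>k. a k) - (\<Sum>k. a k)"
    by (intro tendsto_diff tendsto_const summable_LIMSEQ assms)
  moreover have "(\<Sum>k. a (n + k)) = (\<Sum>k. a k) - (\<Sum>k<n. a k)" for n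
    using suminf_minus_initial_segment[OF assms, of n] by (simp add: add.commute)
  ultimately show ?thesis
    by simp
qed

theorem proposition4p3:
  fixes U :: "'a::{real_inner, polish_space} set"
    and Q :: "'a \<Rightarrow>\<^sub>L 'a"
    and P :: "'a \<times> real \<Rightarrow> 'a measure"
    and f :: "nat \<Rightarrow> 'a"
    and \<mu> :: "nat \<Rightarrow> real"
  assumes U: "subspace U" "closed U" "infinite_dimensional U"
    and Q: "nonneg_op Q" "self_adjoint_op Q" "nuclear_op Q"
    and inv: "invariant_under Q U" "invariant_under Q (U\<^sup>\<bottom>)"
    and model: "\<forall>(\<zeta>, \<sigma>) \<in> U \<times> {0<..}. is_gaussian (P (\<zeta>, \<sigma>)) \<zeta> (\<sigma>\<^sup>2 *\<^sub>R Q)"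
    and f: "orthonormal_system f" "U = closure (span (range f))"
    and \<mu>: "\<forall>k. 0 < \<mu> k" "summable \<mu>"
    and eig: "\<forall>k. blinfun_apply Q (f k) = \<mu> k *\<^sub>R f k"
  shows "\<forall>(\<zeta>, \<sigma>) \<in> U \<times> {0<..}.
     finite_risk P (\<zeta>, \<sigma>) (orth_proj U) \<and>
     (\<forall>n. finite_risk P (\<zeta>, \<sigma>) (orth_proj (span (f ` {..<n}))) \<and>
       (\<lambda>k. (inner \<zeta> (f (n + k)))\<^sup>2 - \<sigma>\<^sup>2 * \<mu> (n + k)) sums
         (risk P (\<zeta>, \<sigma>) (orth_proj (span (f ` {..<n}))) - risk P (\<zeta>, \<sigma>) (orth_proj U))) \<and>
     (\<lambda>n. risk P (\<zeta>, \<sigma>) (orth_proj (span (f ` {..<n}))) - risk P (\<zeta>, \<sigma>) (orth_proj U))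
       \<longlonglongrightarrow> 0"
proof safe
  fix \<zeta> :: 'a and \<sigma> :: real
  assume \<zeta>: "\<zeta> \<in> U" and \<sigma>: "0 < \<sigma>"
  let ?M = "P (\<zeta>, \<sigma>)" and ?V = "\<lambda>n. span (f ` {..<n})"
  let ?v = "\<lambda>k. \<sigma>\<^sup>2 * \<mu> k"
  let ?a = "\<lambda>k. (inner \<zeta> (f k))\<^sup>2 - ?v k"
  have M: "is_gaussian ?M \<zeta> (\<sigma>\<^sup>2 *\<^sub>R Q)"
    using model \<zeta> \<sigma> by auto
  have var: "inner (blinfun_apply (\<sigma>\<^sup>2 *\<^sub>R Q) (f k)) (f k) = ?v k" for k
    using f(1) eig by (simp add: scaleR_blinfun.rep_eq orthonormal_system_def)
  have v: "0 \<le> ?v k" "summable ?v" for k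
    using \<mu> by (simp_all add: less_imp_le summable_mult)
  note selection = integral_coordinate_selection[OF f(1) M var v \<zeta>[unfolded f(2)]]

  have V_in: "orth_proj (?V n) y \<in> closure (span (range f))" for n y
    unfolding orth_proj_finite_span[OF f(1) finite_lessThan]
    by (intro subsetD[OF closure_subset] span_sum span_scale span_base) simp
  have V_coord: "inner (orth_proj (?V n) y) (f k) = (if k \<in> {..<n} then inner y (f k) else 0)" for n y k
    unfolding orth_proj_finite_span[OF f(1) finite_lessThan]
    by (rule inner_orthonormal_sum[OF f(1) finite_lessThan])
  have U_coord: "inner (orth_proj U y) (f k) = (if k \<in> UNIV then inner y (f k) else 0)" for y k
    using orth_proj_closure_span(2)[OF f(1)] f(2) by simp
  have U_in: "orth_proj U y \<in> closure (span (range f))" for y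
    using orth_proj_closure_span(1)[OF f(1)] f(2) by simp

  show "finite_risk P (\<zeta>, \<sigma>) (orth_proj U)"
    using selection(1)[OF U_in U_coord] by (simp add: finite_risk_def sq_loss_def[abs_def])
  show "finite_risk P (\<zeta>, \<sigma>) (orth_proj (?V n))" for n
    using selection(1)[OF V_in V_coord] by (simp add: finite_risk_def sq_loss_def[abs_def])

  have risk_U: "?v sums risk P (\<zeta>, \<sigma>) (orth_proj U)"
    using selection(2)[OF U_in U_coord] by (simp add: risk_def sq_loss_def[abs_def])
  have risk_V: "(\<lambda>k. if k < n then ?v k else (inner \<zeta> (f k))\<^sup>2) sums risk P (\<zeta>, \<sigma>) (orth_proj (?V n))" for n
    using selection(2)[OF V_in V_coord, of n] by (simp add: risk_def sq_loss_def[abs_def])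
  show diff: "(\<lambda>k. ?a (n + k)) sums (risk P (\<zeta>, \<sigma>) (orth_proj (?V n)) - risk P (\<zeta>, \<sigma>) (orth_proj U))" for n
  proof -
    let ?d = "\<lambda>k. (if k < n then ?v k else (inner \<zeta> (f k))\<^sup>2) - ?v k"
    have "?d sums (risk P (\<zeta>, \<sigma>) (orth_proj (?V n)) - risk P (\<zeta>, \<sigma>) (orth_proj U))"
      by (intro sums_diff risk_V risk_U)
    \<comment> \<open>The first \<open>n\<close> terms vanish, so dropping them does not change the sum.\<close>
    then have "(\<lambda>k. ?d (k + n)) sums (risk P (\<zeta>, \<sigma>) (orth_proj (?V n)) - risk P (\<zeta>, \<sigma>) (orth_proj U))"
      by (subst sums_zero_iff_shift) auto
    then show ?thesis
      by (simp add: add.commute)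
  qed
  have "summable ?a"
    using diff[of 0] by (simp add: sums_iff)
  moreover have "risk P (\<zeta>, \<sigma>) (orth_proj (?V n)) - risk P (\<zeta>, \<sigma>) (orth_proj U) = (\<Sum>k. ?a (n + k))" for n
    using diff[of n] by (simp add: sums_iff)
  ultimately show "(\<lambda>n. risk P (\<zeta>, \<sigma>) (orth_proj (?V n)) - risk P (\<zeta>, \<sigma>) (orth_proj U)) \<longlonglongrightarrow> 0"
    using suminf_tail_tendsto_0[of ?a] by simp
qed

end
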